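(* There exists a surjective group homomorphism from $\pi_1(SL_2(\mathbb{R}))$ to $\mathbb{Z}$, where $\pi_1(SL_2(\mathbb{R}))$ is the algebraic fundamental group of the field $\mathbb{R}$ of real numbers (defined via polynomial loops and polynomial homotopies).
   Context: For a commutative ring $R$ with identity, $SL_2(R)$ is the group of $2\times 2$ matrices over $R$ of determinant $1$ and $I_2$ is the identity matrix. Let $L=\{\alpha(T)\in SL_2(R[T]) \mid \alpha(0)=\alpha(1)=I_2\}$ (polynomial loops based at $I_2$). Two loops $\alpha(T),\beta(T)\in L$ are equivalent, $\alpha(T)\sim\beta(T)$, if there exists $\gamma(T,S)\in SL_2(R[T,S])$ with $\gamma(T,0)=\alpha(T)$, $\gamma(T,1)=\beta(T)$ and $\gamma(0,S)=\gamma(1,S)=I_2$. The set of equivalence classes is an abelian group under $[\alpha(T)]*[\beta(T)]=[\alpha(T)\beta(T)]$ (matrix product); it is denoted $\pi_1(SL_2(R))$ and called the algebraic fundamental group of $R$. *)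

theory Defs
  imports "HOL-Analysis.Determinants" "HOL-Computational_Algebra.Polynomial"
    "HOL-Algebra.Elementary_Groups"
begin

section \<open>The algebraic fundamental group of a commutative ring\<close>

definition SL2 :: "('a::comm_ring_1 ^ 2 ^ 2) set" where
  "SL2 = {A. det A = 1}"

text \<open>The ring \<open>R[T]\<close> is rendered as \<open>'a poly\<close>.\<close>

definition loops :: "('a::comm_ring_1 poly ^ 2 ^ 2) set" where
  "loops = {\<alpha> \<in> SL2. map_matrix (\<lambda>p. poly p 0) \<alpha> = mat 1 \<and> map_matrix (\<lambda>p. poly p 1) \<alpha> = mat 1}"

text \<open>
  The ring \<open>R[T,S] = R[T][S]\<close> is rendered as \<open>'a poly poly\<close>: the outer variable is \<open>S\<close> and the
  coefficients are polynomials in \<open>T\<close>. Hence \<open>eval_S c\<close> yields a polynomial in \<open>T\<close>, and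
  \<open>eval_T c\<close>, which evaluates the coefficients, yields a polynomial in \<open>S\<close>.
\<close>

definition eval_S :: "'a::comm_ring_1 \<Rightarrow> 'a poly poly \<Rightarrow> 'a poly" where
  "eval_S c p = poly p [:c:]"

definition eval_T :: "'a::comm_ring_1 \<Rightarrow> 'a poly poly \<Rightarrow> 'a poly" where
  "eval_T c p = map_poly (\<lambda>q. poly q c) p"

definition loop_equiv :: "(('a::comm_ring_1 poly ^ 2 ^ 2) \<times> ('a poly ^ 2 ^ 2)) set" where
  "loop_equiv = {(\<alpha>, \<beta>). \<alpha> \<in> loops \<and> \<beta> \<in> loops \<and>
     (\<exists>\<gamma> \<in> SL2. map_matrix (eval_S 0) \<gamma> = \<alpha> \<and> map_matrix (eval_S 1) \<gamma> = \<beta> \<and>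
        map_matrix (eval_T 0) \<gamma> = mat 1 \<and> map_matrix (eval_T 1) \<gamma> = mat 1)}"

text \<open>
  The product of classes is given by products of representatives; that it does not depend on
  the choice of representatives is the lemma \<open>mult_pi1_class\<close> below.
\<close>

definition pi1_SL2 :: "('a::comm_ring_1 poly ^ 2 ^ 2) set monoid" where
  "pi1_SL2 = \<lparr>carrier = loops // loop_equiv,
     monoid.mult = (\<lambda>A B. \<Union>\<alpha>\<in>A. \<Union>\<beta>\<in>B. loop_equiv `` {\<alpha> ** \<beta>}),
     one = loop_equiv `` {mat 1}\<rparr>"

section \<open>The definitions yield an abelian group\<close>

definition ring_morph :: "('a::comm_ring_1 \<Rightarrow> 'b::comm_ring_1) \<Rightarrow> bool" where
  "ring_morph h \<longleftrightarrow> h 0 = 0 \<and> h 1 = 1 \<and> (\<forall>x y. h (x + y) = h x + h y) \<and> (\<forall>x y. h (x * y) = h x * h y)"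

lemma ring_morph_0: "ring_morph h \<Longrightarrow> h 0 = 0"
  and ring_morph_1: "ring_morph h \<Longrightarrow> h 1 = 1"
  and ring_morph_add: "ring_morph h \<Longrightarrow> h (x + y) = h x + h y"
  and ring_morph_mult: "ring_morph h \<Longrightarrow> h (x * y) = h x * h y"
  unfolding ring_morph_def by blast+

lemma ring_morph_minus: "ring_morph h \<Longrightarrow> h (- x) = - h x"
  using ring_morph_add[of h x "- x"] ring_morph_0[of h] by (simp add: eq_neg_iff_add_eq_0 add.commute)

lemma ring_morph_diff: "ring_morph h \<Longrightarrow> h (x - y) = h x - h y"
  using ring_morph_add[of h x "- y"] by (simp add: ring_morph_minus)

lemma ring_morph_sum: "ring_morph h \<Longrightarrow> h (sum f A) = (\<Sum>x\<in>A. h (f x))"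
  by (induction A rule: infinite_finite_induct) (auto simp: ring_morph_0 ring_morph_add)

lemma ring_morph_poly: "ring_morph (\<lambda>p. poly p c)"
  by (simp add: ring_morph_def)

lemma ring_morph_const: "ring_morph (\<lambda>p. [:p:])"
  by (simp add: ring_morph_def pCons_one)

lemma ring_morph_comp: "ring_morph f \<Longrightarrow> ring_morph g \<Longrightarrow> ring_morph (\<lambda>x. f (g x))"
  by (simp add: ring_morph_def)

lemma ring_morph_map_poly: "ring_morph h \<Longrightarrow> ring_morph (map_poly h)"
  unfolding ring_morph_def[of "map_poly h"]
  by (auto simp: poly_eq_iff coeff_map_poly ring_morph_0 ring_morph_1 ring_morph_add
      ring_morph_sum ring_morph_mult coeff_mult)

lemma ring_morph_eval_S: "ring_morph (eval_S c)"
  unfolding eval_S_def[abs_def] by (rule ring_morph_poly)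

lemma ring_morph_eval_T: "ring_morph (eval_T c)"
  unfolding eval_T_def[abs_def] by (intro ring_morph_map_poly ring_morph_poly)

definition adj2 :: "'a::comm_ring_1 ^ 2 ^ 2 \<Rightarrow> 'a ^ 2 ^ 2" where
  "adj2 A = (\<chi> i j. if i = 1 then (if j = 1 then A $ 2 $ 2 else - A $ 1 $ 2)
                          else (if j = 1 then - A $ 2 $ 1 else A $ 1 $ 1))"

lemma adj2_SL2: "A \<in> SL2 \<Longrightarrow> adj2 A \<in> SL2"
  by (simp add: SL2_def det_2 adj2_def mult.commute)

lemma adj2_inverse:
  assumes "A \<in> SL2" shows "A ** adj2 A = mat 1" "adj2 A ** A = mat 1"
  using assms
  by (auto simp: SL2_def det_2 adj2_def vec_eq_iff forall_2 matrix_matrix_mult_def sum_2 mat_def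
      algebra_simps)

lemma SL2_mult: "A \<in> SL2 \<Longrightarrow> B \<in> SL2 \<Longrightarrow> A ** B \<in> SL2"
  by (simp add: SL2_def det_mul)

lemma SL2_one: "mat 1 \<in> SL2"
  by (simp add: SL2_def)

lemma map_matrix_mult: "ring_morph h \<Longrightarrow> map_matrix h (A ** B) = map_matrix h A ** map_matrix h B"
  by (simp add: vec_eq_iff matrix_matrix_mult_def ring_morph_sum ring_morph_mult)

lemma map_matrix_one: "ring_morph h \<Longrightarrow> map_matrix h (mat 1) = mat 1"
  by (simp add: vec_eq_iff mat_def ring_morph_0 ring_morph_1)

lemma map_matrix_adj2: "ring_morph h \<Longrightarrow> map_matrix h (adj2 A) = adj2 (map_matrix h A)"
  by (simp add: vec_eq_iff adj2_def ring_morph_minus)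

lemma map_matrix_SL2: "ring_morph h \<Longrightarrow> A \<in> SL2 \<Longrightarrow> map_matrix h A \<in> SL2"
  by (simp add: SL2_def det_2 ring_morph_1 flip: ring_morph_diff ring_morph_mult)

lemma map_matrix_comp: "map_matrix f (map_matrix g A) = map_matrix (\<lambda>x. f (g x)) A"
  by (simp add: vec_eq_iff)

lemma adj2_one: "adj2 (mat 1) = mat 1"
  by (simp add: vec_eq_iff adj2_def mat_def forall_2)

lemmas map_matrix_ring = map_matrix_mult map_matrix_one map_matrix_adj2

lemma loops_SL2: "\<alpha> \<in> loops \<Longrightarrow> \<alpha> \<in> SL2"
  by (simp add: loops_def)

lemma loops_eval:
  "\<alpha> \<in> loops \<Longrightarrow> map_matrix (\<lambda>p. poly p 0) \<alpha> = mat 1"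
  "\<alpha> \<in> loops \<Longrightarrow> map_matrix (\<lambda>p. poly p 1) \<alpha> = mat 1"
  by (simp_all add: loops_def)

lemma loops_mult: "\<alpha> \<in> loops \<Longrightarrow> \<beta> \<in> loops \<Longrightarrow> \<alpha> ** \<beta> \<in> loops"
  by (simp add: loops_def SL2_mult map_matrix_mult ring_morph_poly)

lemma loops_one: "mat 1 \<in> loops"
  by (simp add: loops_def SL2_one map_matrix_one ring_morph_poly)

lemma loops_adj2: "\<alpha> \<in> loops \<Longrightarrow> adj2 \<alpha> \<in> loops"
  by (simp add: loops_def adj2_SL2 map_matrix_adj2 ring_morph_poly adj2_one)

lemma eval_const_loop:
  fixes \<alpha> :: "'a::comm_ring_1 poly ^ 2 ^ 2"
  defines "C \<equiv> map_matrix (\<lambda>p. [:p:]) \<alpha>"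
  assumes "\<alpha> \<in> loops"
  shows "C \<in> SL2" "map_matrix (eval_S c) C = \<alpha>"
    "map_matrix (eval_T 0) C = mat 1" "map_matrix (eval_T 1) C = mat 1"
proof -
  show "C \<in> SL2"
    unfolding C_def using assms by (intro map_matrix_SL2 ring_morph_const loops_SL2)
  show "map_matrix (eval_S c) C = \<alpha>"
    by (simp add: C_def vec_eq_iff eval_S_def)
  have *: "map_matrix (eval_T d) C = map_matrix (\<lambda>p. [:p:]) (map_matrix (\<lambda>p. poly p d) \<alpha>)" for d
    by (simp add: C_def vec_eq_iff eval_T_def map_poly_pCons)
  show "map_matrix (eval_T 0) C = mat 1" "map_matrix (eval_T 1) C = mat 1"
    unfolding * using assms by (simp_all add: loops_eval map_matrix_one ring_morph_const)
qed

lemma loop_equivI: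
  assumes "\<alpha> \<in> loops" "\<beta> \<in> loops" "\<gamma> \<in> SL2"
    "map_matrix (eval_S 0) \<gamma> = \<alpha>" "map_matrix (eval_S 1) \<gamma> = \<beta>"
    "map_matrix (eval_T 0) \<gamma> = mat 1" "map_matrix (eval_T 1) \<gamma> = mat 1"
  shows "(\<alpha>, \<beta>) \<in> loop_equiv"
  using assms unfolding loop_equiv_def by auto

lemma loop_equivE:
  assumes "(\<alpha>, \<beta>) \<in> loop_equiv"
  obtains \<gamma> where "\<alpha> \<in> loops" "\<beta> \<in> loops" "\<gamma> \<in> SL2"
    "map_matrix (eval_S 0) \<gamma> = \<alpha>" "map_matrix (eval_S 1) \<gamma> = \<beta>"
    "map_matrix (eval_T 0) \<gamma> = mat 1" "map_matrix (eval_T 1) \<gamma> = mat 1"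
  using assms unfolding loop_equiv_def by auto

lemma loop_equiv_refl: "\<alpha> \<in> loops \<Longrightarrow> (\<alpha>, \<alpha>) \<in> loop_equiv"
  by (rule loop_equivI[where \<gamma> = "map_matrix (\<lambda>p. [:p:]) \<alpha>"]) (simp_all add: eval_const_loop)

lemma loop_equiv_mult:
  assumes "(\<alpha>, \<alpha>') \<in> loop_equiv" "(\<beta>, \<beta>') \<in> loop_equiv"
  shows "(\<alpha> ** \<beta>, \<alpha>' ** \<beta>') \<in> loop_equiv"
proof -
  from assms(1) obtain g where g: "\<alpha> \<in> loops" "\<alpha>' \<in> loops" "g \<in> SL2"
    "map_matrix (eval_S 0) g = \<alpha>" "map_matrix (eval_S 1) g = \<alpha>'"
    "map_matrix (eval_T 0) g = mat 1" "map_matrix (eval_T 1) g = mat 1"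
    by (rule loop_equivE)
  from assms(2) obtain h where h: "\<beta> \<in> loops" "\<beta>' \<in> loops" "h \<in> SL2"
    "map_matrix (eval_S 0) h = \<beta>" "map_matrix (eval_S 1) h = \<beta>'"
    "map_matrix (eval_T 0) h = mat 1" "map_matrix (eval_T 1) h = mat 1"
    by (rule loop_equivE)
  show ?thesis
    by (rule loop_equivI[where \<gamma> = "g ** h"])
      (use g h in \<open>simp_all add: loops_mult SL2_mult map_matrix_mult ring_morph_eval_S ring_morph_eval_T\<close>)
qed

lemma loop_equiv_adj2:
  assumes "(\<alpha>, \<alpha>') \<in> loop_equiv"
  shows "(adj2 \<alpha>, adj2 \<alpha>') \<in> loop_equiv"
proof -
  from assms(1) obtain g where g: "\<alpha> \<in> loops" "\<alpha>' \<in> loops" "g \<in> SL2"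
    "map_matrix (eval_S 0) g = \<alpha>" "map_matrix (eval_S 1) g = \<alpha>'"
    "map_matrix (eval_T 0) g = mat 1" "map_matrix (eval_T 1) g = mat 1"
    by (rule loop_equivE)
  show ?thesis
    by (rule loop_equivI[where \<gamma> = "adj2 g"])
      (use g in \<open>simp_all add: loops_adj2 adj2_SL2 map_matrix_adj2 adj2_one ring_morph_eval_S ring_morph_eval_T\<close>)
qed

lemma loop_equiv_loops: "(\<alpha>, \<beta>) \<in> loop_equiv \<Longrightarrow> \<alpha> \<in> loops \<and> \<beta> \<in> loops"
  by (auto elim: loop_equivE)

lemma loop_equiv_sym:
  assumes "(\<alpha>, \<beta>) \<in> loop_equiv" shows "(\<beta>, \<alpha>) \<in> loop_equiv"
proof -
  have l: "\<alpha> \<in> loops" "\<beta> \<in> loops" using assms loop_equiv_loops by auto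
  have "(\<alpha> ** adj2 \<alpha> ** \<beta>, \<alpha> ** adj2 \<beta> ** \<beta>) \<in> loop_equiv"
    by (intro loop_equiv_mult loop_equiv_adj2 loop_equiv_refl l assms)
  then show ?thesis
    by (simp add: adj2_inverse loops_SL2 l matrix_mul_assoc[symmetric])
qed

lemma loop_equiv_trans:
  assumes "(\<alpha>, \<beta>) \<in> loop_equiv" "(\<beta>, \<delta>) \<in> loop_equiv" shows "(\<alpha>, \<delta>) \<in> loop_equiv"
proof -
  have l: "\<beta> \<in> loops" using assms loop_equiv_loops by auto
  have "(\<alpha> ** adj2 \<beta> ** \<beta>, \<beta> ** adj2 \<beta> ** \<delta>) \<in> loop_equiv"
    by (intro loop_equiv_mult loop_equiv_refl loops_adj2 l assms)
  then show ?thesis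
    by (simp add: adj2_inverse loops_SL2 l flip: matrix_mul_assoc)
qed

theorem equiv_loop_equiv: "equiv loops loop_equiv"
proof (rule equivI)
  show "loop_equiv \<subseteq> loops \<times> loops" using loop_equiv_loops by auto
  show "refl_on loops loop_equiv"
    using loop_equiv_refl loop_equiv_loops by (auto simp: refl_on_def)
  show "sym loop_equiv" using loop_equiv_sym by (rule symI)
  show "trans loop_equiv" using loop_equiv_trans by (rule transI)
qed

lemma class_eq_iff:
  "\<alpha> \<in> loops \<Longrightarrow> \<beta> \<in> loops \<Longrightarrow> loop_equiv `` {\<alpha>} = loop_equiv `` {\<beta>} \<longleftrightarrow> (\<alpha>, \<beta>) \<in> loop_equiv"
  by (rule eq_equiv_class_iff[OF equiv_loop_equiv])

lemma mult_pi1_class: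
  assumes "\<alpha> \<in> loops" "\<beta> \<in> loops"
  shows "(loop_equiv `` {\<alpha>}) \<otimes>\<^bsub>pi1_SL2\<^esub> (loop_equiv `` {\<beta>}) = loop_equiv `` {\<alpha> ** \<beta>}"
proof -
  have "congruent2 loop_equiv loop_equiv (\<lambda>\<alpha> \<beta>. loop_equiv `` {\<alpha> ** \<beta>})"
    by (rule congruent2I')
      (rule equiv_class_eq[OF equiv_loop_equiv loop_equiv_mult])
  from UN_equiv_class2[OF equiv_loop_equiv equiv_loop_equiv this assms] show ?thesis
    by (simp add: pi1_SL2_def)
qed

lemma carrier_pi1: "carrier pi1_SL2 = loops // loop_equiv"
  and one_pi1: "\<one>\<^bsub>pi1_SL2\<^esub> = loop_equiv `` {mat 1}"
  by (simp_all add: pi1_SL2_def)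

definition lift_TS :: "'a::comm_ring_1 poly \<Rightarrow> 'a poly poly" where
  "lift_TS q = poly (map_poly (\<lambda>c. [:[:c:]:]) q) [:0, [:0, 1:]:]"

lemma ring_morph_lift_TS: "ring_morph lift_TS"
proof -
  have "ring_morph (\<lambda>c::'a. [:[:c:]:])"
    by (simp add: ring_morph_def pCons_one)
  from ring_morph_map_poly[OF this] show ?thesis
    by (simp add: ring_morph_def lift_TS_def)
qed

lemma ring_morph_poly_map:
  assumes "ring_morph h" "k 0 = 0"
  shows "h (poly (map_poly k q) x) = poly (map_poly (\<lambda>c. h (k c)) q) (h x)"
proof -
  have "h 0 = 0" using assms by (simp add: ring_morph_0)
  then show ?thesis
    by (induction q) (simp_all add: map_poly_pCons assms ring_morph_add ring_morph_mult)
qed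

lemma poly_map_const: "poly (map_poly (\<lambda>c. [:c:]) q) x = pcompose q x"
  by (induction q) (simp_all add: map_poly_pCons pcompose_pCons)

lemma eval_S_lift_TS: "eval_S c (lift_TS q) = pcompose q [:0, c:]"
  unfolding lift_TS_def
  by (subst ring_morph_poly_map[OF ring_morph_eval_S])
    (simp_all add: eval_S_def poly_map_const)

lemma eval_T_lift_TS: "eval_T c (lift_TS q) = pcompose q [:0, c:]"
  unfolding lift_TS_def
  by (subst ring_morph_poly_map[OF ring_morph_eval_T])
    (simp_all add: eval_T_def poly_map_const map_poly_pCons)

lemma pcompose_zero: "pcompose q [:0, 0:] = [:poly q 0:]"
  by (induction q) (simp_all add: pcompose_pCons)

lemma pcompose_one: "pcompose q [:0, 1:] = (q :: 'a::comm_ring_1 poly)"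
  by (simp add: pcompose_idR)

lemma loop_equiv_commute:
  assumes "\<alpha> \<in> loops" "\<beta> \<in> loops"
  shows "(\<beta> ** \<alpha>, \<alpha> ** \<beta>) \<in> loop_equiv"
proof -
  define A where "A = map_matrix (\<lambda>p. [:p:]) \<alpha>"
  define B where "B = map_matrix (\<lambda>p. [:p:]) \<beta>"
  define G where "G = map_matrix lift_TS \<beta>"
  note A = eval_const_loop[OF assms(1), folded A_def]
  note B = eval_const_loop[OF assms(2), folded B_def]
  have G: "G \<in> SL2"
    unfolding G_def by (intro map_matrix_SL2 ring_morph_lift_TS loops_SL2 assms)
  have z: "map_matrix (\<lambda>q. [:poly q 0:]) \<beta> = mat 1"
    using map_matrix_comp[of "\<lambda>p. [:p:]" "\<lambda>q. poly q 0" \<beta>] assms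
    by (simp add: loops_eval map_matrix_one ring_morph_const)
  have G0: "map_matrix (eval_S 0) G = mat 1" "map_matrix (eval_T 0) G = mat 1"
    unfolding G_def map_matrix_comp eval_S_lift_TS eval_T_lift_TS pcompose_zero by (fact z)+
  have G1: "map_matrix (eval_S 1) G = \<beta>" "map_matrix (eval_T 1) G = \<beta>"
    unfolding G_def map_matrix_comp eval_S_lift_TS eval_T_lift_TS pcompose_one
    by (simp_all add: vec_eq_iff)
  have i: "\<alpha> ** adj2 \<alpha> = mat 1" "\<beta> ** adj2 \<beta> = mat 1" "adj2 \<alpha> ** \<alpha> = mat 1" "adj2 \<beta> ** \<beta> = mat 1"
    using assms by (simp_all add: adj2_inverse loops_SL2)
  have c: "\<alpha> ** \<beta> ** adj2 \<alpha> ** adj2 \<beta> ** \<beta> ** \<alpha> = \<alpha> ** \<beta>"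
  proof -
    have "\<alpha> ** \<beta> ** adj2 \<alpha> ** adj2 \<beta> ** \<beta> ** \<alpha> = \<alpha> ** \<beta> ** (adj2 \<alpha> ** ((adj2 \<beta> ** \<beta>) ** \<alpha>))"
      by (simp only: matrix_mul_assoc)
    then show ?thesis by (simp add: i)
  qed
  show ?thesis
    by (rule loop_equivI[where \<gamma> = "A ** G ** adj2 A ** adj2 G ** B ** A"])
      (simp_all add: A B G G0 G1 i c assms loops_mult SL2_mult adj2_SL2 map_matrix_ring adj2_one
        ring_morph_eval_S ring_morph_eval_T)
qed

theorem comm_group_pi1_SL2: "comm_group (pi1_SL2 :: ('a::comm_ring_1 poly ^ 2 ^ 2) set monoid)"
proof (rule comm_groupI)
  let ?G = "pi1_SL2 :: ('a poly ^ 2 ^ 2) set monoid"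
  fix x y z assume x: "x \<in> carrier ?G" and y: "y \<in> carrier ?G" and z: "z \<in> carrier ?G"
  from x y z obtain a b c where *: "x = loop_equiv `` {a}" "y = loop_equiv `` {b}"
      "z = loop_equiv `` {c}" "a \<in> loops" "b \<in> loops" "c \<in> loops"
    by (metis carrier_pi1 quotientE)
  show "x \<otimes>\<^bsub>?G\<^esub> y \<otimes>\<^bsub>?G\<^esub> z = x \<otimes>\<^bsub>?G\<^esub> (y \<otimes>\<^bsub>?G\<^esub> z)"
    using * by (simp add: mult_pi1_class loops_mult matrix_mul_assoc)
next
  let ?G = "pi1_SL2 :: ('a poly ^ 2 ^ 2) set monoid"
  fix x y assume x: "x \<in> carrier ?G" and y: "y \<in> carrier ?G"
  from x y obtain a b where *: "x = loop_equiv `` {a}" "y = loop_equiv `` {b}"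
      "a \<in> loops" "b \<in> loops"
    by (metis carrier_pi1 quotientE)
  show "x \<otimes>\<^bsub>?G\<^esub> y \<in> carrier ?G"
    using * by (simp add: mult_pi1_class loops_mult carrier_pi1 quotientI)
  show "x \<otimes>\<^bsub>?G\<^esub> y = y \<otimes>\<^bsub>?G\<^esub> x"
    using * by (simp add: mult_pi1_class class_eq_iff loops_mult loop_equiv_commute)
next
  let ?G = "pi1_SL2 :: ('a poly ^ 2 ^ 2) set monoid"
  show "\<one>\<^bsub>?G\<^esub> \<in> carrier ?G"
    by (simp add: carrier_pi1 one_pi1 quotientI loops_one)
  fix x assume x: "x \<in> carrier ?G"
  then obtain a where *: "x = loop_equiv `` {a}" "a \<in> loops"
    by (metis carrier_pi1 quotientE)
  show "\<one>\<^bsub>?G\<^esub> \<otimes>\<^bsub>?G\<^esub> x = x"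
    using * by (simp add: one_pi1 mult_pi1_class loops_one)
  show "\<exists>y\<in>carrier ?G. y \<otimes>\<^bsub>?G\<^esub> x = \<one>\<^bsub>?G\<^esub>"
    using * by (intro bexI[of _ "loop_equiv `` {adj2 a}"])
      (simp_all add: one_pi1 mult_pi1_class loops_adj2 adj2_inverse loops_SL2 carrier_pi1 quotientI)
qed

end

theory Submission
  imports Defs "HOL-Complex_Analysis.Winding_Numbers"
begin

text \<open>
  The first column of a loop, read as a complex number, is a closed path in the punctured plane, and
  its winding number about \<open>0\<close> is invariant under polynomial homotopies. Running through
  \<open>\<alpha>\<close> first and \<open>\<beta>\<close> afterwards deforms the pointwise product \<open>\<alpha>(T)\<beta>(T)\<close> into the
  concatenation of the two paths, so the winding number is additive. With
  \<open>U = E\<^sub>1\<^sub>2(T) E\<^sub>2\<^sub>1(-T) E\<^sub>1\<^sub>2(T)\<close>, the matrix \<open>U(1)\<close> is a rotation by a right angle,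
  and \<open>U\<^sup>4\<close> is a polynomial loop of winding number \<open>-1\<close>.
\<close>

section \<open>The winding number of a polynomial loop\<close>

definition column_complex :: "real ^ 2 ^ 2 \<Rightarrow> complex" where
  "column_complex A = of_real (A $ 1 $ 1) + \<i> * of_real (A $ 2 $ 1)"

definition loop_path :: "real poly ^ 2 ^ 2 \<Rightarrow> real \<Rightarrow> complex" where
  "loop_path \<alpha> t = column_complex (map_matrix (\<lambda>p. poly p t) \<alpha>)"

lemma column_complex_mult:
  fixes A B :: "real ^ 2 ^ 2"
  shows "column_complex (A ** B) =
    of_real (A $ 1 $ 1 * B $ 1 $ 1 + A $ 1 $ 2 * B $ 2 $ 1) +
    \<i> * of_real (A $ 2 $ 1 * B $ 1 $ 1 + A $ 2 $ 2 * B $ 2 $ 1)"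
  by (simp add: column_complex_def matrix_matrix_mult_def sum_2)

text \<open>A vanishing first column would make the determinant 0.\<close>

lemma column_complex_nonzero: "A \<in> SL2 \<Longrightarrow> column_complex A \<noteq> 0"
  by (auto simp: column_complex_def SL2_def det_2 complex_eq_iff)

lemma column_complex_one: "column_complex (mat 1) = 1"
  by (simp add: column_complex_def mat_def)

lemma eval_loop_SL2: "\<alpha> \<in> loops \<Longrightarrow> map_matrix (\<lambda>p. poly p t) \<alpha> \<in> SL2"
  by (intro map_matrix_SL2 ring_morph_poly loops_SL2)

lemma loop_path_closed:
  assumes "\<alpha> \<in> loops"
  shows "path (loop_path \<alpha>)" "pathstart (loop_path \<alpha>) = 1" "pathfinish (loop_path \<alpha>) = 1"
    "0 \<notin> path_image (loop_path \<alpha>)"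
proof -
  show "path (loop_path \<alpha>)"
    unfolding path_def loop_path_def column_complex_def by (auto intro!: continuous_intros)
  show "pathstart (loop_path \<alpha>) = 1" "pathfinish (loop_path \<alpha>) = 1"
    using assms
    by (simp_all only: pathstart_def pathfinish_def loop_path_def loops_eval column_complex_one)
  show "0 \<notin> path_image (loop_path \<alpha>)"
    using column_complex_nonzero[OF eval_loop_SL2[OF assms]]
    by (auto simp: path_image_def loop_path_def)
qed

text \<open>Invariance under free homotopy of loops, in a form suited to explicit formulas: the
  first argument of \<open>h\<close> is the deformation parameter, and the base point may move with
  it.\<close>

lemma winding_number_homotopy:
  fixes h :: "real \<times> real \<Rightarrow> complex"
  assumes "continuous_on ({0..1} \<times> {0..1}) h"
    and "\<And>s t. s \<in> {0..1} \<Longrightarrow> t \<in> {0..1} \<Longrightarrow> h (s, t) \<noteq> z"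
    and "\<And>s. s \<in> {0..1} \<Longrightarrow> h (s, 0) = h (s, 1)"
    and "\<And>t. t \<in> {0..1} \<Longrightarrow> h (0, t) = p t"
    and "\<And>t. t \<in> {0..1} \<Longrightarrow> h (1, t) = q t"
  shows "winding_number p z = winding_number q z"
proof (rule winding_number_homotopic_loops)
  have "h \<in> {0..1} \<times> {0..1} \<rightarrow> - {z}"
    using assms(2) by fast
  with assms show "homotopic_loops (- {z}) p q"
    unfolding homotopic_loops by (intro exI[of _ h]) (simp add: pathstart_def pathfinish_def)
qed

text \<open>The floor and the real part only turn an integral complex number into an
  \<open>int\<close>; on loops nothing is rounded.\<close>

definition winding :: "real poly ^ 2 ^ 2 \<Rightarrow> int" where
  "winding \<alpha> = \<lfloor>Re (winding_number (loop_path \<alpha>) 0)\<rfloor>"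

lemma of_int_winding:
  assumes "\<alpha> \<in> loops"
  shows "of_int (winding \<alpha>) = winding_number (loop_path \<alpha>) 0"
proof -
  have "winding_number (loop_path \<alpha>) 0 \<in> \<int>"
    using loop_path_closed[OF assms] by (intro integer_winding_number) auto
  then show ?thesis
    by (auto simp: winding_def elim!: Ints_cases)
qed

section \<open>Additivity\<close>

lemma winding_mult:
  assumes "\<alpha> \<in> loops" "\<beta> \<in> loops"
  shows "winding (\<alpha> ** \<beta>) = winding \<alpha> + winding \<beta>"
proof -
  \<comment> \<open>The factors get independent times \<open>x\<close> and \<open>y\<close>. Any
    path in the unit square from (0, 0) to (1, 1) then yields a loop; \<open>\<phi>\<close> and
    \<open>\<psi>\<close> move the diagonal to the path along two edges, where one factor is always
    the identity.\<close>
  define M where "M x y = map_matrix (\<lambda>p. poly p x) \<alpha> ** map_matrix (\<lambda>p. poly p y) \<beta>" for x y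
  define \<phi> where "\<phi> s t = (1 - s) * t + s * min 1 (2 * t)" for s t :: real
  define \<psi> where "\<psi> s t = (1 - s) * t + s * max 0 (2 * t - 1)" for s t :: real
  define h where "h = (\<lambda>(s, t). column_complex (M (\<phi> s t) (\<psi> s t)))"
  have M0: "M x 0 = map_matrix (\<lambda>p. poly p x) \<alpha>" and M1: "M 1 x = map_matrix (\<lambda>p. poly p x) \<beta>"
    and Mx: "M x x = map_matrix (\<lambda>p. poly p x) (\<alpha> ** \<beta>)" for x
    using assms by (simp_all only: M_def loops_eval map_matrix_mult[OF ring_morph_poly]
        matrix_mul_lid matrix_mul_rid)
  have "winding_number (loop_path (\<alpha> ** \<beta>)) 0 = winding_number (loop_path \<alpha> +++ loop_path \<beta>) 0"
  proof (rule winding_number_homotopy[of h])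
    show "continuous_on ({0..1} \<times> {0..1}) h"
      unfolding h_def M_def \<phi>_def \<psi>_def column_complex_mult case_prod_unfold
      by (auto intro!: continuous_intros)
    show "h (s, t) \<noteq> 0" for s t
      by (simp only: h_def M_def prod.case)
        (intro column_complex_nonzero SL2_mult eval_loop_SL2 assms)
    show "h (s, 0) = h (s, 1)" for s
      by (simp add: h_def \<phi>_def \<psi>_def M0 M1 loops_eval assms del: nth_map_matrix)
    show "h (0, t) = loop_path (\<alpha> ** \<beta>) t" for t
      by (simp add: h_def \<phi>_def \<psi>_def Mx loop_path_def)
    show "h (1, t) = (loop_path \<alpha> +++ loop_path \<beta>) t" for t
    proof (cases "t \<le> 1 / 2")
      case True
      then have "\<phi> 1 t = 2 * t" "\<psi> 1 t = 0"
        by (simp_all add: \<phi>_def \<psi>_def)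
      with True show ?thesis
        by (simp add: h_def M0 loop_path_def joinpaths_def)
    next
      case False
      then have "\<phi> 1 t = 1" "\<psi> 1 t = 2 * t - 1"
        by (simp_all add: \<phi>_def \<psi>_def)
      with False show ?thesis
        by (simp add: h_def M1 loop_path_def joinpaths_def)
    qed
  qed
  also have "\<dots> = winding_number (loop_path \<alpha>) 0 + winding_number (loop_path \<beta>) 0"
    using loop_path_closed[OF assms(1)] loop_path_closed[OF assms(2)]
    by (intro winding_number_join) auto
  finally show ?thesis
    using assms by (simp add: loops_mult flip: of_int_winding of_int_add)
qed

section \<open>Invariance under polynomial homotopies\<close>

lemma poly_eval_S: "poly (eval_S s p) t = poly (eval_T t p) s"
  unfolding eval_S_def eval_T_def by (induction p) (simp_all add: map_poly_pCons)

lemma continuous_on_poly_eval_S: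
  fixes p :: "'a::real_normed_field poly poly"
  shows "continuous_on A (\<lambda>x. poly (eval_S (fst x) p) (snd x))"
  unfolding eval_S_def by (induction p) (auto intro!: continuous_intros)

lemma winding_loop_equiv:
  assumes "(\<alpha>, \<beta>) \<in> loop_equiv"
  shows "winding \<alpha> = winding \<beta>"
proof -
  from assms obtain g where g: "g \<in> SL2"
    "map_matrix (eval_S 0) g = \<alpha>" "map_matrix (eval_S 1) g = \<beta>"
    "map_matrix (eval_T 0) g = mat 1" "map_matrix (eval_T 1) g = mat 1"
    by (rule loop_equivE)
  define M where "M s t = map_matrix (\<lambda>p. poly p t) (map_matrix (eval_S s) g)" for s t
  \<comment> \<open>Evaluating at \<open>T\<close> first makes the boundary conditions on
    \<open>g\<close> applicable, so that each stage of the homotopy is closed.\<close>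
  have M': "M s t = map_matrix (\<lambda>p. poly p s) (map_matrix (eval_T t) g)" for s t
    by (simp add: M_def vec_eq_iff poly_eval_S)
  have "winding_number (loop_path \<alpha>) 0 = winding_number (loop_path \<beta>) 0"
  proof (rule winding_number_homotopy[of "\<lambda>x. column_complex (M (fst x) (snd x))"])
    show "continuous_on ({0..1} \<times> {0..1}) (\<lambda>x. column_complex (M (fst x) (snd x)))"
      unfolding M_def column_complex_def nth_map_matrix
      by (intro continuous_intros continuous_on_poly_eval_S)
    have "M s t \<in> SL2" for s t
      unfolding M_def by (intro map_matrix_SL2 ring_morph_poly ring_morph_eval_S g)
    then show "column_complex (M (fst (s, t)) (snd (s, t))) \<noteq> 0" for s t
      by (rule column_complex_nonzero)
    show "column_complex (M (fst (s, 0)) (snd (s, 0))) = column_complex (M (fst (s, 1)) (snd (s, 1)))"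
      for s by (simp add: M' g)
  qed (simp_all add: M_def g loop_path_def)
  then show ?thesis
    by (simp add: winding_def)
qed

section \<open>A loop of winding number minus one\<close>

definition quarter_turn :: "real poly ^ 2 ^ 2" where
  "quarter_turn = vector [vector [[:1, 0, -1:], [:0, 2, 0, -1:]], vector [[:0, -1:], [:1, 0, -1:]]]"

definition full_turn :: "real poly ^ 2 ^ 2" where
  "full_turn = (quarter_turn ** quarter_turn) ** (quarter_turn ** quarter_turn)"

lemma eval_full_turn:
  fixes t :: real
  defines "U \<equiv> vector [vector [1 - t^2, 2 * t - t^3], vector [- t, 1 - t^2]]"
  shows "map_matrix (\<lambda>p. poly p t) full_turn = (U ** U) ** (U ** U)"
proof -
  have "map_matrix (\<lambda>p. poly p t) quarter_turn = U"
    by (simp add: vec_eq_iff forall_2 quarter_turn_def U_def power2_eq_square power3_eq_cube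
        algebra_simps)
  then show ?thesis
    by (simp only: full_turn_def map_matrix_mult[OF ring_morph_poly])
qed

lemma full_turn_loop: "full_turn \<in> loops"
proof -
  have "quarter_turn \<in> SL2"
    by (simp add: SL2_def det_2 quarter_turn_def one_pCons)
  then have "full_turn \<in> SL2"
    by (simp add: full_turn_def SL2_mult)
  then show ?thesis
    unfolding loops_def eval_full_turn mem_Collect_eq
    by (simp add: vec_eq_iff forall_2 matrix_matrix_mult_def sum_2 mat_def)
qed

text \<open>\<open>quarter_turn\<close> has determinant 1 and both diagonal entries
  \<open>c\<close>, so by Cayley-Hamilton its powers obey the Chebyshev recurrence. The two
  polynomials in \<open>c\<close> are the Chebyshev polynomials T_4 and U_3, the latter multiplied
  by the lower left entry \<open>-t\<close>.\<close>

lemma loop_path_full_turn: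
  fixes t :: real
  defines "c \<equiv> 1 - t^2"
  shows "loop_path full_turn t =
    of_real (8 * c^4 - 8 * c^2 + 1) - \<i> * of_real (t * (4 * c * (2 * c^2 - 1)))"
  unfolding loop_path_def eval_full_turn column_complex_mult c_def
  by (simp add: matrix_matrix_mult_def sum_2 complex_eq_iff) algebra

lemma sin_cos_4:
  fixes x :: real
  shows "cos (4 * x) = 8 * cos x ^ 4 - 8 * cos x ^ 2 + 1"
    "sin (4 * x) = 4 * sin x * cos x * (2 * cos x ^ 2 - 1)"
proof -
  have "4 * x = 2 * (2 * x)" by simp
  then show "cos (4 * x) = 8 * cos x ^ 4 - 8 * cos x ^ 2 + 1"
    "sin (4 * x) = 4 * sin x * cos x * (2 * cos x ^ 2 - 1)"
    by (simp_all only: cos_double_cos sin_double)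
      (simp_all add: algebra_simps power2_eq_square power4_eq_xxxx)
qed

lemma winding_full_turn: "winding full_turn = - 1"
proof -
  text \<open>
    If \<open>cos \<theta> = 1 - t\<^sup>2\<close> then the path is \<open>cos 4\<theta> - \<i> \<lambda> sin 4\<theta>\<close> with
    \<open>\<lambda> = 1 / sqrt (2 - t\<^sup>2)\<close>. As \<open>\<lambda> > 0\<close>, both \<open>\<lambda>\<close> and the angle can be
    deformed linearly to those of the clockwise unit circle.
  \<close>
  define \<theta> where "\<theta> s t = (1 - s) * arccos (1 - t^2) + s * (pi / 2 * t)" for s t :: real
  define l where "l s t = (1 - s) / sqrt (2 - t^2) + s" for s t :: real
  define h where "h = (\<lambda>(s, t). of_real (cos (4 * \<theta> s t)) - \<i> * of_real (l s t * sin (4 * \<theta> s t)))"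
  have sq: "t^2 \<le> 1" if "t \<in> {0..1}" for t :: real
    using that by (simp add: power_le_one)
  have "winding_number (loop_path full_turn) 0 = winding_number (reversepath (circlepath 0 1)) 0"
  proof (rule winding_number_homotopy[of h])
    \<comment> \<open>The bound \<open>sq\<close> keeps 1 - t^2 in the domain of
      \<open>arccos\<close> and 2 - t^2 away from 0.\<close>
    show "continuous_on ({0..1} \<times> {0..1}) h"
      unfolding h_def \<theta>_def l_def case_prod_unfold
      by (intro continuous_intros) (use sq in \<open>fastforce+\<close>)
    fix s t :: real
    assume t: "t \<in> {0..1}"
    show "h (s, t) \<noteq> 0" if "s \<in> {0..1}"
    proof
      assume "h (s, t) = 0"
      then have "cos (4 * \<theta> s t) = 0" "l s t * sin (4 * \<theta> s t) = 0"
        by (simp_all add: h_def complex_eq_iff)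
      moreover have "l s t > 0"
        using that sq[OF t] unfolding l_def
        by (cases "s = 0") (auto intro!: add_nonneg_pos)
      ultimately show False
        using sin_cos_squared_add[of "4 * \<theta> s t"] by simp
    qed
    have r: "sqrt (2 - t^2) > 0" using sq[OF t] by simp
    have "sin (\<theta> 0 t) = sqrt (1 - (1 - t^2)^2)"
      using sq[OF t] by (simp add: \<theta>_def sin_arccos)
    also have "1 - (1 - t^2)^2 = t^2 * (2 - t^2)"
      by (simp add: power2_eq_square algebra_simps)
    also have "sqrt \<dots> = t * sqrt (2 - t^2)"
      using t by (simp add: real_sqrt_mult)
    finally have s: "sin (\<theta> 0 t) = t * sqrt (2 - t^2)" .
    have c: "cos (\<theta> 0 t) = 1 - t^2"
      using sq[OF t] by (simp add: \<theta>_def)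
    \<comment> \<open>The denominator of \<open>l 0 t\<close> cancels the square root in
      \<open>s\<close>, which leaves a polynomial in \<open>t\<close>.\<close>
    have "l 0 t * sin (4 * \<theta> 0 t) = t * (4 * (1 - t^2) * (2 * (1 - t^2)^2 - 1))"
      unfolding sin_cos_4 s c using r by (simp add: l_def)
    then show "h (0, t) = loop_path full_turn t"
      by (simp only: loop_path_full_turn h_def prod.case sin_cos_4(1) c)
    have "4 * \<theta> 1 t = 2 * pi * t" "l 1 t = 1"
      by (simp_all add: \<theta>_def l_def)
    then have "h (1, t) = of_real (cos (2 * pi * t)) - \<i> * of_real (sin (2 * pi * t))"
      by (simp only: h_def prod.case mult_1)
    then show "h (1, t) = reversepath (circlepath 0 1) t"
      by (simp add: reversepath_def circlepath complex_eq_iff Re_exp Im_exp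
          cos_diff sin_diff algebra_simps)
  next
    fix s :: real
    have "4 * \<theta> s 0 = 0" "4 * \<theta> s 1 = 2 * pi"
      by (simp_all add: \<theta>_def field_simps)
    \<comment> \<open>The scale \<open>l\<close> may differ at the two ends, but the sine that it
      multiplies vanishes at both.\<close>
    then show "h (s, 0) = h (s, 1)"
      by (simp only: h_def prod.case) simp
  qed
  also have "\<dots> = - 1"
    by (simp add: winding_number_reversepath winding_number_circlepath)
  finally show ?thesis
    by (simp add: winding_def floor_eq_iff)
qed

theorem theorem4p2:
  shows "\<exists>f. f \<in> hom (pi1_SL2 :: (real poly ^ 2 ^ 2) set monoid) integer_group \<and>
           f ` carrier (pi1_SL2 :: (real poly ^ 2 ^ 2) set monoid) = carrier integer_group"
proof -
  let ?G = "pi1_SL2 :: (real poly ^ 2 ^ 2) set monoid"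
  define f where "f X = winding (SOME \<alpha>. \<alpha> \<in> X)" for X
  have f_class: "f (loop_equiv `` {\<alpha>}) = winding \<alpha>" if "\<alpha> \<in> loops" for \<alpha>
  proof -
    \<comment> \<open>By reflexivity the class is nonempty, so the chosen representative is
      equivalent to \<open>\<alpha>\<close>.\<close>
    have "(\<alpha>, SOME \<beta>. \<beta> \<in> loop_equiv `` {\<alpha>}) \<in> loop_equiv"
      using someI[of "\<lambda>\<beta>. \<beta> \<in> loop_equiv `` {\<alpha>}" \<alpha>] loop_equiv_refl[OF that] by simp
    then show ?thesis
      by (simp add: f_def winding_loop_equiv)
  qed
  have hom: "f \<in> hom ?G integer_group"
  proof (rule homI)
    fix x y assume "x \<in> carrier ?G" "y \<in> carrier ?G"
    then obtain \<alpha> \<beta> where "x = loop_equiv `` {\<alpha>}" "y = loop_equiv `` {\<beta>}" "\<alpha> \<in> loops" "\<beta> \<in> loops"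
      by (metis carrier_pi1 quotientE)
    then show "f (x \<otimes>\<^bsub>?G\<^esub> y) = f x \<otimes>\<^bsub>integer_group\<^esub> f y"
      by (simp add: mult_pi1_class f_class loops_mult winding_mult)
  qed simp
  define g where "g = loop_equiv `` {full_turn}"
  have g: "g \<in> carrier ?G"
    by (simp add: g_def carrier_pi1 quotientI full_turn_loop)
  have G: "group ?G"
    using comm_group_pi1_SL2 by (rule comm_group.axioms)
  \<comment> \<open>The exponent is negated because \<open>g\<close> is sent to -1.\<close>
  have "f (g [^]\<^bsub>?G\<^esub> (- n)) = n" for n :: int
    using hom_int_pow[OF hom g G group_integer_group, of "- n"]
    by (simp add: g_def f_class full_turn_loop winding_full_turn)
  then have "n \<in> f ` carrier ?G" for n
    using group.int_pow_closed[OF G g] by (metis imageI)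
  then show ?thesis
    using hom by auto
qed

end
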